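(* Let $\mathcal{H}$ be a real Hilbert space, let $C_1,C_2,C_3\subseteq\mathcal{H}$ be closed and convex sets with nonempty intersection, and suppose that $q\in\operatorname{ran}(\mathrm{Id}+N_{C_1}+N_{C_2}+N_{C_3})$. Let $\beta\in\left]0,1\right[$ and $\lambda\in\left]0,1\right]$. Given any $x_0,y_0\in\mathcal{H}$, consider the sequences given, for $k\in\mathbb{N}$, by $$\left\{\begin{aligned} u_k&=P_{C_1}\left(\beta x_k+(1-\beta)q\right)\\ v_k&=P_{C_2}\left(\beta(u_k+y_k)-(2\beta-1)q\right)\\ w_k&=P_{C_3}\left(\beta(u_k-x_k+v_k-y_k)+q\right)\\ x_{k+1}&=x_k+\lambda(w_k-u_k)\\ y_{k+1}&=y_k+\lambda(w_k-v_k).\end{aligned}\right.$$ Then $u_k\to u=P_{C_1\cap C_2\cap C_3}(q)$ in norm as $k\to+\infty$. Furthermore, if $\lambda\neq1$, then $(x_k)$ converges weakly to some $x\in\mathcal{H}$ with $P_{C_1}\left(\beta x+(1-\beta)q\right)=u$.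
   Context: For a nonempty closed convex set $C\subseteq\mathcal{H}$, $P_C$ denotes the projector onto $C$ (nearest point map), and $N_C$ the convex normal cone operator: $N_C(x)=\{u\in\mathcal{H}:\langle u,c-x\rangle\le0\ \forall c\in C\}$ if $x\in C$ and $N_C(x)=\emptyset$ otherwise. $\operatorname{ran}T=\{u:\exists x,\ u\in T(x)\}$ for a set-valued operator $T$, and sums of set-valued operators are pointwise Minkowski sums. *)

theory Defs
  imports "HOL-Analysis.Analysis" "HOL-Library.Set_Algebras"
begin

(* The library's closest_point is restricted to sort heine_borel, i.e. to finite dimension. *)
definition projector :: "'a::real_inner set \<Rightarrow> 'a \<Rightarrow> 'a" where
  "projector C a = (THE p. p \<in> C \<and> (\<forall>c\<in>C. dist a p \<le> dist a c))"

definition normal_cone :: "'a::real_inner set \<Rightarrow> 'a \<Rightarrow> 'a set" where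
  "normal_cone C x = (if x \<in> C then {u. \<forall>c\<in>C. u \<bullet> (c - x) \<le> 0} else {})"

definition ran_op :: "('a \<Rightarrow> 'b set) \<Rightarrow> 'b set" where
  "ran_op T = {u. \<exists>x. u \<in> T x}"

(* Only the functionals given by the inner product are tested; by Riesz these are all
   continuous linear functionals when the space is complete. *)
definition weakly_converges_to :: "(nat \<Rightarrow> 'a::real_inner) \<Rightarrow> 'a \<Rightarrow> bool" where
  "weakly_converges_to X l \<longleftrightarrow> (\<forall>z. (\<lambda>k. X k \<bullet> z) \<longlonglongrightarrow> l \<bullet> z)"

end

theory Submission
  imports Defs
begin

text \<open>Write \<open>q = p + n1 + n2 + n3\<close> with \<open>ni\<close> in the normal cone of \<open>Ci\<close> at \<open>p\<close>; then \<open>p\<close> is the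
projection of \<open>q\<close> onto the intersection, and rescaling the \<open>ni\<close> by \<open>3 (1 - \<beta>)\<close> yields a fixed point
\<open>(x*, y*)\<close> of the iteration with \<open>u = v = w = p\<close>. Adding up the three monotonicity inequalities of the
normal cones shows that the squared distance of \<open>(x k, y k)\<close> to every such fixed point decreases by
at least \<open>2 \<lambda> (1 - \<beta>) / \<beta>\<close> times \<open>|u k - p|^2 + |v k - p|^2 + |w k - p|^2\<close>, so that \<open>u\<close>, \<open>v\<close> and \<open>w\<close>
converge in norm to \<open>p\<close>.

Weak convergence is an Opial argument in which weak sequential compactness is replaced by the fact
that a decreasing sequence of nonempty bounded closed convex sets has a common point: the closed
convex hulls of the tails of \<open>(x k, y k)\<close> can only meet in fixed points, because the latter are
described by linear inequalities which the iterates satisfy asymptotically.\<close>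

subsection \<open>Projections and decreasing sequences of convex sets\<close>

text \<open>Cutting \<open>K n\<close> down to balls about \<open>a\<close> with radii shrinking to
  the limit distance \<open>d\<close> leaves sets whose diameters tend to 0, so completeness gives a
  common point. A constant sequence yields nearest points; a bounded one stands in for weak
  compactness.\<close>

lemma decreasing_closed_convex_common_point:
  fixes K :: "nat \<Rightarrow> 'a::{real_inner, complete_space} set"
  assumes clo: "\<And>n. closed (K n)" and conv: "\<And>n. convex (K n)" and ne: "\<And>n. K n \<noteq> {}"
    and dec: "\<And>m n. m \<le> n \<Longrightarrow> K n \<subseteq> K m" and lim: "(\<lambda>n. infdist a (K n)) \<longlonglongrightarrow> d"
    and le: "\<And>n. infdist a (K n) \<le> d"
  obtains p where "\<And>n. p \<in> K n" "dist a p \<le> d"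
proof -
  \<comment> \<open>The slack \<open>1 / Suc n\<close> keeps \<open>S n\<close> nonempty, since the
    distance to \<open>K n\<close> is so far only an infimum.\<close>
  define S where "S n = K n \<inter> cball a (d + 1 / Suc n)" for n
  have d0: "0 \<le> d"
    using le[of 0] infdist_nonneg[of a "K 0"] by linarith
  have ne': "S n \<noteq> {}" for n
  proof -
    have "infdist a (K n) < d + 1 / Suc n"
      using le[of n] by (smt (verit) divide_pos_pos of_nat_0_less_iff zero_less_Suc zero_less_one)
    then have "(INF b\<in>K n. dist a b) < d + 1 / Suc n"
      using ne[of n] by (simp add: infdist_def)
    then obtain b where "b \<in> K n" "dist a b < d + 1 / Suc n"
      using ne[of n] by (meson cINF_less_iff bdd_below_image_dist)
    then show ?thesis
      by (auto simp: S_def)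
  qed
  \<comment> \<open>Parallelogram law: the midpoint of \<open>b\<close> and \<open>c\<close> lies in
    \<open>K n\<close> by convexity, so it is no closer to \<open>a\<close> than \<open>K n\<close>
    is.\<close>
  have diam: "(dist b c)\<^sup>2 \<le> 4 * (d + 1 / Suc n)\<^sup>2 - 4 * (infdist a (K n))\<^sup>2"
    if "b \<in> S n" "c \<in> S n" for b c n
  proof -
    have "(1/2) *\<^sub>R b + (1/2) *\<^sub>R c \<in> K n"
      using that convexD[OF conv] by (auto simp: S_def)
    then have "infdist a (K n) \<le> dist a ((1/2) *\<^sub>R b + (1/2) *\<^sub>R c)"
      by (rule infdist_le)
    then have 1: "(infdist a (K n))\<^sup>2 \<le> (dist a ((1/2) *\<^sub>R b + (1/2) *\<^sub>R c))\<^sup>2"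
      by (intro power_mono infdist_nonneg)
    have 2: "(dist a b)\<^sup>2 \<le> (d + 1 / Suc n)\<^sup>2" "(dist a c)\<^sup>2 \<le> (d + 1 / Suc n)\<^sup>2"
      using that by (auto simp: S_def intro!: power_mono)
    have "(dist b c)\<^sup>2 = 2 * (dist a b)\<^sup>2 + 2 * (dist a c)\<^sup>2
        - 4 * (dist a ((1/2) *\<^sub>R b + (1/2) *\<^sub>R c))\<^sup>2"
      by (simp add: dist_norm power2_norm_eq_inner inner_simps inner_commute algebra_simps)
    with 1 2 show ?thesis
      by linarith
  qed
  have lim0: "(\<lambda>n. 4 * (d + 1 / Suc n)\<^sup>2 - 4 * (infdist a (K n))\<^sup>2) \<longlonglongrightarrow> 4 * (d + 0)\<^sup>2 - 4 * d\<^sup>2"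
    by (intro tendsto_intros lim LIMSEQ_Suc[OF lim_1_over_n])
  have "\<exists>p. \<forall>n. p \<in> S n"
  proof (rule decreasing_closed_nest)
    show "closed (S n)" for n
      unfolding S_def by (intro closed_Int clo closed_cball)
    show "S n \<subseteq> S m" if "m \<le> n" for m n
    proof -
      have "1 / real (Suc n) \<le> 1 / real (Suc m)"
        using that by (simp add: frac_le)
      then show ?thesis
        using dec[OF that] by (auto simp: S_def)
    qed
    show "\<exists>n. \<forall>b\<in>S n. \<forall>c\<in>S n. dist b c < e" if "e > 0" for e
    proof -
      have "\<forall>\<^sub>F n in sequentially. 4 * (d + 1 / Suc n)\<^sup>2 - 4 * (infdist a (K n))\<^sup>2 < e\<^sup>2"
        using that by (intro order_tendstoD(2)[OF lim0]) simp
      then obtain n where "4 * (d + 1 / Suc n)\<^sup>2 - 4 * (infdist a (K n))\<^sup>2 < e\<^sup>2"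
        by (auto simp: eventually_sequentially)
      then have "(dist b c)\<^sup>2 < e\<^sup>2" if "b \<in> S n" "c \<in> S n" for b c
        using diam[OF that] by linarith
      then show ?thesis
        using that by (meson less_imp_le power_less_imp_less_base)
    qed
  qed (use ne' in auto)
  then obtain p where p: "\<And>n. p \<in> S n"
    by auto
  have "dist a p \<le> d + 0"
  proof (rule tendsto_lowerbound)
    show "(\<lambda>n. d + 1 / Suc n) \<longlonglongrightarrow> d + 0"
      by (intro tendsto_intros LIMSEQ_Suc[OF lim_1_over_n])
    show "\<forall>\<^sub>F n in sequentially. dist a p \<le> d + 1 / Suc n"
      using p by (auto simp: S_def)
  qed auto
  with p that show thesis
    by (auto simp: S_def)
qed

text \<open>The distances from 0 to the shrinking sets increase and are bounded, so their limit can
  serve as \<open>d\<close> above.\<close>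

lemma bounded_decreasing_closed_convex_common_point:
  fixes K :: "nat \<Rightarrow> 'a::{real_inner, complete_space} set"
  assumes clo: "\<And>n. closed (K n)" and conv: "\<And>n. convex (K n)" and ne: "\<And>n. K n \<noteq> {}"
    and dec: "\<And>m n. m \<le> n \<Longrightarrow> K n \<subseteq> K m" and bdd: "bounded (K 0)"
  obtains p where "\<And>n. p \<in> K n"
proof -
  obtain B where B: "\<And>b. b \<in> K 0 \<Longrightarrow> dist 0 b \<le> B"
    using bdd by (auto simp: bounded_any_center[of _ 0])
  have le: "infdist 0 (K n) \<le> B" for n
  proof -
    obtain b where "b \<in> K n"
      using ne[of n] by auto
    then show ?thesis
      using infdist_le[of b "K n" 0] B dec[of 0 n] by force
  qed
  have inc: "incseq (\<lambda>n. infdist 0 (K n))"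
    by (intro monoI infdist_mono dec ne)
  obtain d where d: "(\<lambda>n. infdist 0 (K n)) \<longlonglongrightarrow> d" "\<forall>n. infdist 0 (K n) \<le> d"
    by (rule incseq_convergent[OF inc, of B]) (use le in auto)
  show thesis
    by (rule decreasing_closed_convex_common_point[OF clo conv ne dec d(1)]) (use d(2) that in auto)
qed

text \<open>Expanding the square turns the angle condition into the Pythagorean inequality
  \<open>sq\<close>, which gives both the minimality of \<open>p\<close> and the uniqueness that
  \<open>THE\<close> requires.\<close>

lemma projector_eqI:
  fixes C :: "'a::real_inner set"
  assumes "p \<in> C" and "\<And>c. c \<in> C \<Longrightarrow> (a - p) \<bullet> (c - p) \<le> 0"
  shows "projector C a = p"
proof -
  have sq: "(dist a p)\<^sup>2 + (dist p c)\<^sup>2 \<le> (dist a c)\<^sup>2" if "c \<in> C" for c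
  proof -
    have "(dist a c)\<^sup>2 = (dist a p)\<^sup>2 + (dist p c)\<^sup>2 - 2 * ((a - p) \<bullet> (c - p))"
      by (simp add: dist_norm power2_norm_eq_inner inner_simps inner_commute algebra_simps)
    with assms(2)[OF that] show ?thesis
      by linarith
  qed
  show ?thesis
    unfolding projector_def
  proof (rule the_equality)
    have "dist a p \<le> dist a c" if "c \<in> C" for c
      using sq[OF that] by (rule power2_le_imp_le[OF order_trans[rotated]]) simp_all
    then show "p \<in> C \<and> (\<forall>c\<in>C. dist a p \<le> dist a c)"
      using assms(1) by auto
    fix r
    assume r: "r \<in> C \<and> (\<forall>c\<in>C. dist a r \<le> dist a c)"
    then have "(dist a r)\<^sup>2 \<le> (dist a p)\<^sup>2"
      using assms(1) by (auto intro!: power_mono)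
    with sq[OF conjunct1[OF r]] have "(dist p r)\<^sup>2 \<le> 0"
      by linarith
    then show "r = p"
      by simp
  qed
qed

lemma projector_normal_cone:
  fixes C :: "'a::{real_inner, complete_space} set"
  assumes "closed C" "convex C" "C \<noteq> {}"
  shows "a - projector C a \<in> normal_cone C (projector C a)"
proof -
  obtain p where p: "p \<in> C" "dist a p \<le> infdist a C"
    using decreasing_closed_convex_common_point[of "\<lambda>_. C" a "infdist a C"] assms by auto
  have "\<forall>c\<in>C. dist a p \<le> dist a c"
    using p(2) by (meson infdist_le order_trans)
  then have le: "(a - p) \<bullet> (c - p) \<le> 0" if "c \<in> C" for c
    using any_closest_point_dot[OF assms(2,1) p(1) that] by simp
  with p(1) have "projector C a = p"
    by (intro projector_eqI)
  with p(1) le show ?thesis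
    by (simp add: normal_cone_def)
qed

lemma projector_eq_if_normal_cone:
  assumes "a - p \<in> normal_cone C p"
  shows "projector C a = p"
  using assms by (intro projector_eqI) (auto simp: normal_cone_def split: if_splits)

section \<open>Elementary properties of normal cones\<close>

lemma normal_cone_memD: "a \<in> normal_cone C p \<Longrightarrow> p \<in> C"
  by (auto simp: normal_cone_def split: if_splits)

lemma normal_cone_inner_le: "a \<in> normal_cone C p \<Longrightarrow> c \<in> C \<Longrightarrow> a \<bullet> (c - p) \<le> 0"
  by (auto simp: normal_cone_def split: if_splits)

lemma normal_cone_scaleR: "a \<in> normal_cone C p \<Longrightarrow> 0 \<le> t \<Longrightarrow> t *\<^sub>R a \<in> normal_cone C p"
  by (auto simp: normal_cone_def mult_nonneg_nonpos split: if_splits)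

lemma normal_cone_monotone:
  assumes "a \<in> normal_cone C p" "b \<in> normal_cone C r"
  shows "0 \<le> (a - b) \<bullet> (p - r)"
  using normal_cone_inner_le[OF assms(1) normal_cone_memD[OF assms(2)]]
    normal_cone_inner_le[OF assms(2) normal_cone_memD[OF assms(1)]]
  by (simp add: inner_simps)

subsection \<open>Weak convergence of Fejer monotone sequences\<close>

text \<open>For bounded sequences this takes the place of the set of weak cluster points, all of
  which it contains because closed convex sets are weakly closed.\<close>

definition tail_hulls :: "(nat \<Rightarrow> 'a::real_normed_vector) \<Rightarrow> 'a set" where
  "tail_hulls z = (\<Inter>n. closure (convex hull (z ` {n..})))"

lemma tail_hulls_nonempty:
  fixes z :: "nat \<Rightarrow> 'a::{real_inner, complete_space}"
  assumes "bounded (range z)"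
  shows "tail_hulls z \<noteq> {}"
proof -
  obtain p where "\<And>n. p \<in> closure (convex hull (z ` {n..}))"
  proof (rule bounded_decreasing_closed_convex_common_point)
    show "bounded (closure (convex hull (z ` {0..})))"
      using assms by (intro bounded_closure bounded_convex_hull) (simp add: atLeast_0)
    show "closure (convex hull (z ` {n..})) \<subseteq> closure (convex hull (z ` {m..}))" if "m \<le> n" for m n
      using that by (intro closure_mono hull_mono image_mono) auto
  qed (auto intro: convex_closure)
  then show ?thesis
    by (auto simp: tail_hulls_def)
qed

text \<open>A closed half-space containing a tail contains its closed convex hull, so linear
  inequalities that hold asymptotically pass to the common points of the hulls.\<close>

lemma tail_hulls_inner_le:
  fixes z :: "nat \<Rightarrow> 'a::real_inner"
  assumes s: "s \<in> tail_hulls z" and lim: "f \<longlonglongrightarrow> r" and le: "\<And>k. h \<bullet> z k \<le> f k"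
  shows "h \<bullet> s \<le> r"
proof (rule field_le_epsilon)
  fix e :: real
  assume "0 < e"
  then have "\<forall>\<^sub>F k in sequentially. f k < r + e"
    by (intro order_tendstoD(2)[OF lim]) simp
  then obtain N where "\<And>k. k \<ge> N \<Longrightarrow> f k < r + e"
    by (auto simp: eventually_sequentially)
  then have "z ` {N..} \<subseteq> {s. h \<bullet> s \<le> r + e}"
    using le by (force intro: order_trans less_imp_le)
  then have "closure (convex hull (z ` {N..})) \<subseteq> {s. h \<bullet> s \<le> r + e}"
    by (intro closure_minimal hull_minimal convex_halfspace_le closed_halfspace_le)
  with s show "h \<bullet> s \<le> r + e"
    by (auto simp: tail_hulls_def)
qed

lemma tail_hulls_inner_eq:
  fixes z :: "nat \<Rightarrow> 'a::real_inner"
  assumes s: "s \<in> tail_hulls z" and lim: "(\<lambda>k. h \<bullet> z k) \<longlonglongrightarrow> r"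
  shows "h \<bullet> s = r"
proof (rule antisym)
  show "h \<bullet> s \<le> r"
    by (rule tail_hulls_inner_le[OF s lim]) simp
  have "(- h) \<bullet> s \<le> - r"
    by (rule tail_hulls_inner_le[OF s tendsto_minus[OF lim]]) simp
  then show "r \<le> h \<bullet> s"
    by simp
qed

lemma tail_hulls_subseq:
  assumes "strict_mono r"
  shows "tail_hulls (z \<circ> r) \<subseteq> tail_hulls z"
proof -
  have "closure (convex hull ((z \<circ> r) ` {n..})) \<subseteq> closure (convex hull (z ` {n..}))" for n
    using seq_suble[OF assms] by (intro closure_mono hull_mono) (force intro: order_trans)
  then show ?thesis
    by (fastforce simp: tail_hulls_def)
qed

text \<open>If the functional \<open>h\<close> exceeded its value at \<open>s\<close> by
  \<open>e\<close> infinitely often, the tail hulls of that subsequence would have a common point,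
  which satisfies the same inequality and yet lies in \<open>tail_hulls z\<close>.\<close>

lemma weakly_converges_to_if_tail_hulls_le_one:
  fixes z :: "nat \<Rightarrow> 'a::{real_inner, complete_space}"
  assumes bdd: "bounded (range z)" and uniq: "tail_hulls z \<subseteq> {s}"
  shows "weakly_converges_to z s"
proof -
  have upper: "\<forall>\<^sub>F k in sequentially. h \<bullet> z k < h \<bullet> s + e" if "0 < e" for h e
  proof (rule ccontr)
    assume "\<not> ?thesis"
    then have "infinite {k. h \<bullet> s + e \<le> h \<bullet> z k}"
      by (auto simp: not_eventually not_less frequently_cofinite simp flip: cofinite_eq_sequentially)
    then obtain r :: "nat \<Rightarrow> nat"
      where r: "strict_mono r" "\<And>n. r n \<in> {k. h \<bullet> s + e \<le> h \<bullet> z k}"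
      using infinite_enumerate by blast
    have "bounded (range (z \<circ> r))"
      by (rule bounded_subset[OF bdd]) auto
    then obtain t where t: "t \<in> tail_hulls (z \<circ> r)"
      using tail_hulls_nonempty by blast
    have "(- h) \<bullet> (z \<circ> r) k \<le> - (h \<bullet> s + e)" for k
      using r(2)[of k] by simp
    then have "(- h) \<bullet> t \<le> - (h \<bullet> s + e)"
      by (rule tail_hulls_inner_le[OF t tendsto_const])
    moreover have "t = s"
      using t tail_hulls_subseq[OF r(1)] uniq by blast
    ultimately show False
      using that by simp
  qed
  have "(\<lambda>k. z k \<bullet> h) \<longlonglongrightarrow> s \<bullet> h" for h
  proof (rule order_tendstoI)
    fix a
    show "\<forall>\<^sub>F k in sequentially. z k \<bullet> h < a" if "s \<bullet> h < a"
      using upper[of "a - s \<bullet> h" h] that by (simp add: inner_commute)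
    show "\<forall>\<^sub>F k in sequentially. a < z k \<bullet> h" if "a < s \<bullet> h"
      using upper[of "s \<bullet> h - a" "- h"] that by (simp add: inner_commute)
  qed
  then show ?thesis
    by (simp add: weakly_converges_to_def)
qed

lemma fejer_weakly_convergent:
  fixes z :: "nat \<Rightarrow> 'a::{real_inner, complete_space}"
  assumes bdd: "bounded (range z)" and sub: "tail_hulls z \<subseteq> F"
    and fejer: "\<And>s. s \<in> F \<Longrightarrow> convergent (\<lambda>k. (norm (z k - s))\<^sup>2)"
  obtains s where "s \<in> F" "weakly_converges_to z s"
proof -
  obtain s where s: "s \<in> tail_hulls z"
    using tail_hulls_nonempty[OF bdd] by auto
  have "t = s" if t: "t \<in> tail_hulls z" for t
  proof -
    obtain l m where "(\<lambda>k. (norm (z k - s))\<^sup>2) \<longlonglongrightarrow> l" "(\<lambda>k. (norm (z k - t))\<^sup>2) \<longlonglongrightarrow> m"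
      using fejer s t sub by (meson convergentD subsetD)
    \<comment> \<open>The squares of \<open>z k\<close> cancel, so this convergent combination is
      linear in \<open>z k\<close>. Hence the functional given by \<open>t - s\<close> takes one
      value on all of \<open>tail_hulls z\<close>, in particular at \<open>s\<close> and
      \<open>t\<close>.\<close>
    then have "(\<lambda>k. ((norm (z k - s))\<^sup>2 - (norm (z k - t))\<^sup>2 - (norm s)\<^sup>2 + (norm t)\<^sup>2) / 2)
        \<longlonglongrightarrow> (l - m - (norm s)\<^sup>2 + (norm t)\<^sup>2) / 2"
      by (intro tendsto_intros) auto
    moreover have "((norm (z k - s))\<^sup>2 - (norm (z k - t))\<^sup>2 - (norm s)\<^sup>2 + (norm t)\<^sup>2) / 2 = (t - s) \<bullet> z k" for k
      by (simp add: power2_norm_eq_inner inner_simps inner_commute field_simps)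
    ultimately have lim: "(\<lambda>k. (t - s) \<bullet> z k) \<longlonglongrightarrow> (l - m - (norm s)\<^sup>2 + (norm t)\<^sup>2) / 2"
      by simp
    have "(t - s) \<bullet> (t - s) = 0"
      using tail_hulls_inner_eq[OF s lim] tail_hulls_inner_eq[OF t lim] by (simp add: inner_diff_right)
    then show ?thesis
      by simp
  qed
  then have "weakly_converges_to z s"
    by (intro weakly_converges_to_if_tail_hulls_le_one[OF bdd]) auto
  with s sub that show thesis
    by blast
qed

text \<open>The strong-weak closedness of the graph of the normal cone, with hulls of tails in place of
weak limits.\<close>

lemma normal_cone_tail_hulls:
  fixes z :: "nat \<Rightarrow> 'a::real_inner" and T :: "'a \<Rightarrow> 'b::real_inner"
  assumes s: "s \<in> tail_hulls z" and bdd: "bounded (range z)" and T: "bounded_linear T"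
    and adj: "\<And>a b. T a \<bullet> b = a \<bullet> T' b"
    and u: "u \<longlonglongrightarrow> p" and e: "e \<longlonglongrightarrow> l" and C: "closed C"
    and mem: "\<And>k. T (z k) + e k \<in> normal_cone C (u k)"
  shows "T s + l \<in> normal_cone C p"
proof -
  have "u k \<in> C" for k
    using mem normal_cone_memD by blast
  then have p: "p \<in> C"
    using closed_sequentially[OF C _ u] by blast
  \<comment> \<open>A bounded sequence paired with a null sequence: replacing \<open>u k\<close> by
    \<open>p\<close> costs nothing in the limit.\<close>
  have "bounded (range (\<lambda>k. T (z k)))"
    using bounded_linear_image[OF bdd T] by (simp add: image_image)
  then have "Bfun (\<lambda>k. T (z k)) sequentially"
    using Bseq_eq_bounded by blast
  moreover have "Zfun (\<lambda>k. u k - p) sequentially"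
    using u by (simp add: tendsto_Zfun_iff)
  ultimately have "Zfun (\<lambda>k. T (z k) \<bullet> (u k - p)) sequentially"
    by (rule bounded_bilinear.Bfun_prod_Zfun[OF bounded_bilinear_inner])
  then have lim0: "(\<lambda>k. T (z k) \<bullet> (u k - p)) \<longlonglongrightarrow> 0"
    by (simp add: tendsto_Zfun_iff)
  have "(T s + l) \<bullet> (c - p) \<le> 0" if c: "c \<in> C" for c
  proof -
    \<comment> \<open>Split \<open>T (z k) \<bullet> (c - p)\<close> at \<open>u k\<close>: the
      normal cone inequality bounds one part by \<open>- e k \<bullet> (c - u k)\<close>, so the
      whole bound converges. The adjoint \<open>T'\<close> makes the left side a functional of
      \<open>z k\<close>.\<close>
    have "T' (c - p) \<bullet> s \<le> 0 - l \<bullet> (c - p)"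
    proof (rule tail_hulls_inner_le[OF s])
      show "(\<lambda>k. T (z k) \<bullet> (u k - p) - e k \<bullet> (c - u k)) \<longlonglongrightarrow> 0 - l \<bullet> (c - p)"
        by (intro tendsto_intros lim0 e u)
      show "T' (c - p) \<bullet> z k \<le> T (z k) \<bullet> (u k - p) - e k \<bullet> (c - u k)" for k
        using normal_cone_inner_le[OF mem c, of k]
        by (simp add: inner_commute[of "T' _"] adj[symmetric] inner_simps)
    qed
    then show ?thesis
      by (simp add: inner_commute[of "T' _"] adj[symmetric] inner_simps)
  qed
  with p show ?thesis
    by (simp add: normal_cone_def)
qed

subsection \<open>Ryu's splitting\<close>

text \<open>The variables stand for deviations from a fixed point, so \<open>q\<close> has dropped
  out and the last three hypotheses are the monotonicity inequalities of the normal cones, to be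
  added up.\<close>

lemma ryu_descent:
  fixes x y u v w :: "'a::real_inner"
  assumes \<beta>: "0 < \<beta>" and lam: "0 < lam" "lam \<le> 1"
    and u: "0 \<le> (\<beta> *\<^sub>R x - u) \<bullet> u"
    and v: "0 \<le> (\<beta> *\<^sub>R (u + y) - v) \<bullet> v"
    and w: "0 \<le> (\<beta> *\<^sub>R (u - x + v - y) - w) \<bullet> w"
  shows "(norm (x + lam *\<^sub>R (w - u)))\<^sup>2 + (norm (y + lam *\<^sub>R (w - v)))\<^sup>2
      + 2 * lam * (1 - \<beta>) / \<beta> * ((norm u)\<^sup>2 + (norm v)\<^sup>2 + (norm w)\<^sup>2)
    \<le> (norm x)\<^sup>2 + (norm y)\<^sup>2"
proof -
  let ?S = "(norm u)\<^sup>2 + (norm v)\<^sup>2 + (norm w)\<^sup>2"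
  let ?E = "x \<bullet> (w - u) + y \<bullet> (w - v)"
  let ?D = "(norm (u - v))\<^sup>2 + (norm (w - u))\<^sup>2 + (norm (w - v))\<^sup>2"
  \<comment> \<open>The mixed products are eliminated by
    \<open>u \<bullet> v + u \<bullet> w + v \<bullet> w = ?S - ?D / 2\<close>.\<close>
  have "(\<beta> *\<^sub>R x - u) \<bullet> u + (\<beta> *\<^sub>R (u + y) - v) \<bullet> v + (\<beta> *\<^sub>R (u - x + v - y) - w) \<bullet> w
      = - \<beta> * ?E - (1 - \<beta>) * ?S - \<beta> / 2 * ?D"
    by (simp add: power2_norm_eq_inner inner_simps inner_commute algebra_simps)
  then have "\<beta> * ?E \<le> \<beta> * (- ((1 - \<beta>) / \<beta> * ?S) - ?D / 2)"
    using u v w \<beta> by (simp add: right_diff_distrib)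
  then have "?E \<le> - ((1 - \<beta>) / \<beta> * ?S) - ?D / 2"
    using \<beta> by (simp only: mult_le_cancel_left_pos)
  then have "2 * lam * ?E \<le> 2 * lam * (- ((1 - \<beta>) / \<beta> * ?S) - ?D / 2)"
    using lam by (intro mult_left_mono) auto
  moreover have "(norm (x + lam *\<^sub>R (w - u)))\<^sup>2 + (norm (y + lam *\<^sub>R (w - v)))\<^sup>2
      = (norm x)\<^sup>2 + (norm y)\<^sup>2 + 2 * lam * ?E
        + lam * lam * ((norm (w - u))\<^sup>2 + (norm (w - v))\<^sup>2)"
    unfolding power2_norm_eq_inner
    by (simp add: inner_simps inner_commute algebra_simps)
  \<comment> \<open>Since \<open>lam \<le> 1\<close>, the second-order term of the update is
    absorbed by two of the summands of \<open>lam * ?D\<close>.\<close>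
  moreover have "lam * lam * ((norm (w - u))\<^sup>2 + (norm (w - v))\<^sup>2)
      \<le> lam * 1 * ((norm (w - u))\<^sup>2 + (norm (w - v))\<^sup>2)"
    using lam by (intro mult_mono) auto
  moreover have "0 \<le> lam * (norm (u - v))\<^sup>2"
    using lam by simp
  moreover have "2 * lam * (- ((1 - \<beta>) / \<beta> * ?S) - ?D / 2) = - (2 * lam * (1 - \<beta>) / \<beta> * ?S)
      - lam * (norm (u - v))\<^sup>2 - lam * 1 * ((norm (w - u))\<^sup>2 + (norm (w - v))\<^sup>2)"
    using \<beta> by (simp add: field_simps)
  ultimately show ?thesis
    by linarith
qed

text \<open>A nonnegative decreasing sequence converges, so its consecutive differences, which
  dominate \<open>c * S k\<close>, tend to 0.\<close>

lemma descent_tendsto_zero: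
  fixes g S :: "nat \<Rightarrow> real"
  assumes "0 < c" and g: "\<And>k. 0 \<le> g k" and S: "\<And>k. 0 \<le> S k"
    and step: "\<And>k. g (Suc k) + c * S k \<le> g k"
  shows "convergent g" "S \<longlonglongrightarrow> 0"
proof -
  have "decseq g"
  proof (rule decseq_SucI)
    show "g (Suc k) \<le> g k" for k
      using step[of k] mult_nonneg_nonneg[of c "S k"] S[of k] \<open>0 < c\<close> by linarith
  qed
  then obtain l where l: "g \<longlonglongrightarrow> l"
    using decseq_convergent[of g 0] g by blast
  then show "convergent g"
    by (rule convergentI)
  have "(\<lambda>k. (g k - g (Suc k)) / c) \<longlonglongrightarrow> (l - l) / c"
    using \<open>0 < c\<close> by (intro tendsto_intros l LIMSEQ_Suc[OF l]) auto
  moreover have "S k \<le> (g k - g (Suc k)) / c" for k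
    using step[of k] \<open>0 < c\<close> by (simp add: field_simps)
  ultimately show "S \<longlonglongrightarrow> 0"
    using S by (intro tendsto_sandwich[of "\<lambda>_. 0" S sequentially "\<lambda>k. (g k - g (Suc k)) / c"]) auto
qed

theorem corollary3:
  fixes C1 C2 C3 :: "'a::{real_inner, complete_space} set"
    and q x0 y0 :: 'a
    and \<beta> lam :: real
    and u v w x y :: "nat \<Rightarrow> 'a"
  assumes "closed C1" "convex C1" "closed C2" "convex C2" "closed C3" "convex C3"
    and "C1 \<inter> C2 \<inter> C3 \<noteq> {}"
    and "q \<in> ran_op (\<lambda>z. {z} + normal_cone C1 z + normal_cone C2 z + normal_cone C3 z)"
    and "0 < \<beta>" "\<beta> < 1"
    and "0 < lam" "lam \<le> 1"
    and "x 0 = x0" "y 0 = y0"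
    and "\<And>k. u k = projector C1 (\<beta> *\<^sub>R x k + (1 - \<beta>) *\<^sub>R q)"
    and "\<And>k. v k = projector C2 (\<beta> *\<^sub>R (u k + y k) - (2 * \<beta> - 1) *\<^sub>R q)"
    and "\<And>k. w k = projector C3 (\<beta> *\<^sub>R (u k - x k + v k - y k) + q)"
    and "\<And>k. x (Suc k) = x k + lam *\<^sub>R (w k - u k)"
    and "\<And>k. y (Suc k) = y k + lam *\<^sub>R (w k - v k)"
  shows "u \<longlonglongrightarrow> projector (C1 \<inter> C2 \<inter> C3) q \<and>
    (lam \<noteq> 1 \<longrightarrow> (\<exists>xs. weakly_converges_to x xs \<and>
      projector C1 (\<beta> *\<^sub>R xs + (1 - \<beta>) *\<^sub>R q) = projector (C1 \<inter> C2 \<inter> C3) q))"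
proof -
  obtain p n1 n2 n3 where n: "n1 \<in> normal_cone C1 p" "n2 \<in> normal_cone C2 p" "n3 \<in> normal_cone C3 p"
    and q: "q = p + n1 + n2 + n3"
    using assms(8) by (auto simp: ran_op_def elim!: set_plus_elim)
  have proj: "projector (C1 \<inter> C2 \<inter> C3) q = p"
  proof (rule projector_eqI)
    show "p \<in> C1 \<inter> C2 \<inter> C3"
      using n normal_cone_memD by blast
    show "(q - p) \<bullet> (c - p) \<le> 0" if "c \<in> C1 \<inter> C2 \<inter> C3" for c
      using that n[THEN normal_cone_inner_le, of c] by (simp add: q inner_add_left)
  qed
  \<comment> \<open>\<open>F\<close> consists of the pairs at which the three projections all equal
    \<open>p\<close>. Each inclusion puts the part linear in the pair first and the constants last,
    the form \<open>T s + l\<close> of \<open>normal_cone_tail_hulls\<close>.\<close>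
  define F where "F = {s. \<beta> *\<^sub>R fst s + ((1 - \<beta>) *\<^sub>R q - p) \<in> normal_cone C1 p \<and>
    \<beta> *\<^sub>R snd s + (\<beta> *\<^sub>R p - (2 * \<beta> - 1) *\<^sub>R q - p) \<in> normal_cone C2 p \<and>
    - \<beta> *\<^sub>R (fst s + snd s) + (\<beta> *\<^sub>R (p + p) + q - p) \<in> normal_cone C3 p}"
  define z where "z k = (x k, y k)" for k
  define S where "S k = (norm (u k - p))\<^sup>2 + (norm (v k - p))\<^sup>2 + (norm (w k - p))\<^sup>2" for k
  have ne: "C1 \<noteq> {}" "C2 \<noteq> {}" "C3 \<noteq> {}"
    using assms(7) by auto
  \<comment> \<open>The three projections of the iteration as inclusions, sorted in the same way as
    in \<open>F\<close>.\<close>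
  have N1: "\<beta> *\<^sub>R x k + ((1 - \<beta>) *\<^sub>R q - u k) \<in> normal_cone C1 (u k)" for k
    using projector_normal_cone[OF assms(1,2) ne(1), of "\<beta> *\<^sub>R x k + (1 - \<beta>) *\<^sub>R q"]
    unfolding assms(15)[symmetric] by (simp add: algebra_simps)
  have N2: "\<beta> *\<^sub>R y k + (\<beta> *\<^sub>R u k - (2 * \<beta> - 1) *\<^sub>R q - v k) \<in> normal_cone C2 (v k)" for k
    using projector_normal_cone[OF assms(3,4) ne(2), of "\<beta> *\<^sub>R (u k + y k) - (2 * \<beta> - 1) *\<^sub>R q"]
    unfolding assms(16)[symmetric] by (simp add: algebra_simps)
  have N3: "- \<beta> *\<^sub>R (x k + y k) + (\<beta> *\<^sub>R (u k + v k) + q - w k) \<in> normal_cone C3 (w k)" for k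
    using projector_normal_cone[OF assms(5,6) ne(3), of "\<beta> *\<^sub>R (u k - x k + v k - y k) + q"]
    unfolding assms(17)[symmetric] by (simp add: algebra_simps)
  have c: "0 < 2 * lam * (1 - \<beta>) / \<beta>"
    using assms(9-12) by simp
  \<comment> \<open>Monotonicity is applied between the inclusions \<open>N1\<close>,
    \<open>N2\<close>, \<open>N3\<close> and those of \<open>F\<close>; in the differences
    \<open>q\<close> cancels.\<close>
  have step: "(norm (z (Suc k) - s))\<^sup>2 + 2 * lam * (1 - \<beta>) / \<beta> * S k \<le> (norm (z k - s))\<^sup>2"
    if s: "s \<in> F" for s k
  proof -
    obtain a b where ab: "s = (a, b)"
      by fastforce
    have "(norm (x k - a + lam *\<^sub>R (w k - p - (u k - p))))\<^sup>2
        + (norm (y k - b + lam *\<^sub>R (w k - p - (v k - p))))\<^sup>2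
        + 2 * lam * (1 - \<beta>) / \<beta> * ((norm (u k - p))\<^sup>2 + (norm (v k - p))\<^sup>2 + (norm (w k - p))\<^sup>2)
      \<le> (norm (x k - a))\<^sup>2 + (norm (y k - b))\<^sup>2"
    proof (rule ryu_descent)
      show "0 \<le> (\<beta> *\<^sub>R (x k - a) - (u k - p)) \<bullet> (u k - p)"
        using normal_cone_monotone[OF N1, of "\<beta> *\<^sub>R a + ((1 - \<beta>) *\<^sub>R q - p)" p k] s
        by (simp add: F_def ab algebra_simps)
      show "0 \<le> (\<beta> *\<^sub>R (u k - p + (y k - b)) - (v k - p)) \<bullet> (v k - p)"
        using normal_cone_monotone[OF N2, of "\<beta> *\<^sub>R b + (\<beta> *\<^sub>R p - (2 * \<beta> - 1) *\<^sub>R q - p)" p k] s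
        by (simp add: F_def ab algebra_simps)
      show "0 \<le> (\<beta> *\<^sub>R (u k - p - (x k - a) + (v k - p) - (y k - b)) - (w k - p)) \<bullet> (w k - p)"
        using normal_cone_monotone[OF N3, of "- \<beta> *\<^sub>R (a + b) + (\<beta> *\<^sub>R (p + p) + q - p)" p k] s
        by (simp add: F_def ab algebra_simps)
    qed (use assms(9-12) in auto)
    then show ?thesis
      by (simp add: z_def ab S_def norm_Pair assms(18,19) algebra_simps)
  qed
  \<comment> \<open>The pair solves the first two inclusions of \<open>F\<close> with the normal
    vectors \<open>t *\<^sub>R n1\<close> and \<open>t *\<^sub>R n2\<close>. The left sides of all
    three add up to \<open>(3 * (1 - \<beta>)) *\<^sub>R (q - p)\<close>, which forces
    \<open>t = 3 * (1 - \<beta>)\<close> for the third to give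
    \<open>t *\<^sub>R n3\<close>.\<close>
  have s0: "((p - (1 - \<beta>) *\<^sub>R q + (3 * (1 - \<beta>)) *\<^sub>R n1) /\<^sub>R \<beta>,
      ((2 * \<beta> - 1) *\<^sub>R q + p - \<beta> *\<^sub>R p + (3 * (1 - \<beta>)) *\<^sub>R n2) /\<^sub>R \<beta>) \<in> F" (is "?s \<in> F")
  proof -
    have b: "\<beta> *\<^sub>R fst ?s = p - (1 - \<beta>) *\<^sub>R q + (3 * (1 - \<beta>)) *\<^sub>R n1"
      "\<beta> *\<^sub>R snd ?s = (2 * \<beta> - 1) *\<^sub>R q + p - \<beta> *\<^sub>R p + (3 * (1 - \<beta>)) *\<^sub>R n2"
      using assms(9) by simp_all
    have "\<beta> *\<^sub>R fst ?s + ((1 - \<beta>) *\<^sub>R q - p) = (3 * (1 - \<beta>)) *\<^sub>R n1"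
      "\<beta> *\<^sub>R snd ?s + (\<beta> *\<^sub>R p - (2 * \<beta> - 1) *\<^sub>R q - p) = (3 * (1 - \<beta>)) *\<^sub>R n2"
      unfolding b by (simp_all add: algebra_simps)
    moreover have "- \<beta> *\<^sub>R (fst ?s + snd ?s) + (\<beta> *\<^sub>R (p + p) + q - p) = (3 * (1 - \<beta>)) *\<^sub>R n3"
    proof -
      have "- \<beta> *\<^sub>R (fst ?s + snd ?s) = - (\<beta> *\<^sub>R fst ?s) - \<beta> *\<^sub>R snd ?s"
        by (simp only: scaleR_right_distrib scaleR_minus_left minus_add_distrib) simp
      also have "\<dots> + (\<beta> *\<^sub>R (p + p) + q - p) = (3 * (1 - \<beta>)) *\<^sub>R (q - p - n1 - n2)"
      proof -
        have "(3::real) *\<^sub>R a = a + a + a" for a :: 'a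
          using scaleR_add_left[of 2 1 a] by (simp add: scaleR_2)
        then show ?thesis
          unfolding b by (simp add: algebra_simps scaleR_2 flip: scaleR_scaleR)
      qed
      finally show ?thesis
        by (simp add: q)
    qed
    ultimately show ?thesis
      using n assms(10) by (auto simp: F_def intro!: normal_cone_scaleR simp del: fst_conv snd_conv)
  qed

  \<comment> \<open>Norm convergence of the three projected sequences\<close>
  have "S \<longlonglongrightarrow> 0"
    using step[OF s0] by (intro descent_tendsto_zero(2)[OF c, of "\<lambda>k. (norm (z k - ?s))\<^sup>2"]) (auto simp: S_def)
  then have "(\<lambda>k. sqrt (S k)) \<longlonglongrightarrow> 0"
    using tendsto_real_sqrt by fastforce
  moreover have "norm (u k - p) \<le> sqrt (S k)" "norm (v k - p) \<le> sqrt (S k)" "norm (w k - p) \<le> sqrt (S k)" for k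
    by (auto simp: S_def intro!: real_le_rsqrt)
  ultimately have u: "u \<longlonglongrightarrow> p" and v: "v \<longlonglongrightarrow> p" and w: "w \<longlonglongrightarrow> p"
    by (auto intro!: LIM_zero_cancel[of _ p] Lim_null_comparison[of _ "\<lambda>k. sqrt (S k)"])

  \<comment> \<open>Weak convergence of the pairs\<close>
  have conv: "convergent (\<lambda>k. (norm (z k - s))\<^sup>2)" if "s \<in> F" for s
    using step[OF that] by (intro descent_tendsto_zero(1)[OF c, of _ S]) (auto simp: S_def)
  have bdd: "bounded (range z)"
  proof -
    obtain B where B: "\<And>k. (norm (z k - ?s))\<^sup>2 \<le> B"
      using convergent_imp_Bseq[OF conv[OF s0]] by (auto simp: Bseq_def)
    have "dist ?s (z k) \<le> sqrt B" for k
      using B[of k] by (intro real_le_rsqrt) (simp add: dist_norm norm_minus_commute)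
    then show ?thesis
      by (auto simp: bounded_def)
  qed
  \<comment> \<open>As \<open>u\<close>, \<open>v\<close>, \<open>w\<close> converge in norm, the
    constants in \<open>N1\<close>, \<open>N2\<close>, \<open>N3\<close> converge to those in
    \<open>F\<close>. Each \<open>T'\<close> is the adjoint of the linear part, with values in the
    product space.\<close>
  have sub: "tail_hulls z \<subseteq> F"
  proof
    fix s
    assume s: "s \<in> tail_hulls z"
    have "\<beta> *\<^sub>R fst s + ((1 - \<beta>) *\<^sub>R q - p) \<in> normal_cone C1 p"
    proof (rule normal_cone_tail_hulls[OF s bdd, where T' = "\<lambda>b. (\<beta> *\<^sub>R b, 0)", OF _ _ u _ assms(1)])
      show "bounded_linear (\<lambda>s::'a \<times> 'a. \<beta> *\<^sub>R fst s)"
        by (intro bounded_linear_intros)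
      show "(\<lambda>k. (1 - \<beta>) *\<^sub>R q - u k) \<longlonglongrightarrow> (1 - \<beta>) *\<^sub>R q - p"
        by (intro tendsto_intros u)
    qed (use N1 in \<open>auto simp: z_def inner_prod_def\<close>)
    moreover have "\<beta> *\<^sub>R snd s + (\<beta> *\<^sub>R p - (2 * \<beta> - 1) *\<^sub>R q - p) \<in> normal_cone C2 p"
    proof (rule normal_cone_tail_hulls[OF s bdd, where T' = "\<lambda>b. (0, \<beta> *\<^sub>R b)", OF _ _ v _ assms(3)])
      show "bounded_linear (\<lambda>s::'a \<times> 'a. \<beta> *\<^sub>R snd s)"
        by (intro bounded_linear_intros)
      show "(\<lambda>k. \<beta> *\<^sub>R u k - (2 * \<beta> - 1) *\<^sub>R q - v k) \<longlonglongrightarrow> \<beta> *\<^sub>R p - (2 * \<beta> - 1) *\<^sub>R q - p"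
        by (intro tendsto_intros u v)
    qed (use N2 in \<open>auto simp: z_def inner_prod_def\<close>)
    moreover have "- \<beta> *\<^sub>R (fst s + snd s) + (\<beta> *\<^sub>R (p + p) + q - p) \<in> normal_cone C3 p"
    proof (rule normal_cone_tail_hulls[OF s bdd, where T' = "\<lambda>b. (- \<beta> *\<^sub>R b, - \<beta> *\<^sub>R b)", OF _ _ w _ assms(5)])
      show "bounded_linear (\<lambda>s::'a \<times> 'a. - \<beta> *\<^sub>R (fst s + snd s))"
        by (intro bounded_linear_intros)
      show "(\<lambda>k. \<beta> *\<^sub>R (u k + v k) + q - w k) \<longlonglongrightarrow> \<beta> *\<^sub>R (p + p) + q - p"
        by (intro tendsto_intros u v w)
    qed (use N3 in \<open>auto simp: z_def inner_prod_def inner_simps algebra_simps\<close>)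
    ultimately show "s \<in> F"
      by (simp add: F_def)
  qed
  obtain s where s: "s \<in> F" "weakly_converges_to z s"
    using fejer_weakly_convergent[OF bdd sub conv] by blast
  \<comment> \<open>Testing with \<open>(h, 0)\<close> extracts the first component.\<close>
  have "(\<lambda>k. x k \<bullet> h) \<longlonglongrightarrow> fst s \<bullet> h" for h
  proof -
    have "(\<lambda>k. z k \<bullet> (h, 0)) \<longlonglongrightarrow> s \<bullet> (h, 0)"
      using s(2) by (simp add: weakly_converges_to_def)
    then show ?thesis
      by (simp add: z_def inner_prod_def)
  qed
  then have "weakly_converges_to x (fst s)"
    by (simp add: weakly_converges_to_def)
  \<comment> \<open>The first inclusion of \<open>F\<close> characterizes this projection.\<close>
  moreover have "projector C1 (\<beta> *\<^sub>R fst s + (1 - \<beta>) *\<^sub>R q) = p"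
    using s(1) by (intro projector_eq_if_normal_cone) (simp add: F_def algebra_simps)
  ultimately show ?thesis
    using u unfolding proj by blast
qed

end
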